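(* There exist a probability density function $\rho$ on $[0,1]$ (with respect to Lebesgue measure) and a probability distribution $q$ supported on a countably infinite set $\operatorname{supp}q$ of probability density functions on $[0,1]$, such that $$\mathrm e(\rho\|\operatorname{supp}q)\le\mathrm e(\rho\|q)<\inf_{\sigma\in\operatorname{supp}q}\mathrm e(\rho\|\sigma)$$ for each of the exponents $\mathrm e=\mathrm s$ (Stein), $\mathrm e=\mathrm c$ (Chernoff), and $\mathrm e=\mathrm d_r$, $r>0$ (direct). Moreover, the first inequality is also strict for $\mathrm e=\mathrm s$, $\mathrm e=\mathrm c$, and $\mathrm e=\mathrm d_r$ with $0<r<\mathrm s(\rho\|q)$.
   Context: For a probability density $\omega$ on $[0,1]$, $\omega^{\otimes n}$ is the product density on $[0,1]^n$. A test on $n$ samples is a measurable function $T_n:[0,1]^n\to[0,1]$ (an element of $L^\infty([0,1]^n)$ with $0\le T_n\le1$), and $\omega^{\otimes n}(T_n)=\int_{[0,1]^n}\omega^{\otimes n}T_n\,d\lambda$. The distribution $q$ is a discrete distribution on probability densities, and $\operatorname{supp}q$ is the set of densities $\sigma$ with $q(\sigma)>0$. The type I error is $\alpha_n(T_n)=\rho^{\otimes n}(1-T_n)$. The type II error is: for $\mathrm e(\rho\|\sigma)$: $\beta_n(T_n)=\sigma^{\otimes n}(T_n)$; for $\mathrm e(\rho\|q)$: $\beta_n(T_n)=\sum_{\sigma\in\operatorname{supp}q}q(\sigma)\,\sigma^{\otimes n}(T_n)$; for $\mathrm e(\rho\|\operatorname{supp}q)$: $\beta_n(T_n)=\sup_{\sigma\in\operatorname{supp}q}\sigma^{\otimes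 n}(T_n)$. In each case ($\log$ natural, $-\log0=+\infty$): the Stein exponent $\mathrm s$ is the supremum of $\liminf_n-\frac1n\log\beta_n(T_n)$ over test sequences with $\lim_n\alpha_n(T_n)=0$; the direct exponent $\mathrm d_r$ is the supremum of $\liminf_n-\frac1n\log\alpha_n(T_n)$ over test sequences with $\liminf_n-\frac1n\log\beta_n(T_n)\ge r$; the Chernoff exponent $\mathrm c$ is the supremum of all $r\ge0$ for which some test sequence satisfies both $\liminf_n-\frac1n\log\alpha_n(T_n)\ge r$ and $\liminf_n-\frac1n\log\beta_n(T_n)\ge r$. *)

theory Defs
  imports "HOL-Probability.Probability"
begin

definition unit_leb :: "real measure" where
  "unit_leb = restrict_space lborel {0..1}"

definition cube :: "nat \<Rightarrow> (nat \<Rightarrow> real) measure" where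
  "cube n = (\<Pi>\<^sub>M i\<in>{..<n}. unit_leb)"

text \<open>
  The Bochner integral of a non-integrable function is 0, so the last conjunct includes
  integrability. Borel measurability is used throughout; this loses nothing, because every
  Lebesgue measurable density or test has a Borel representative.
\<close>

definition prob_density :: "(real \<Rightarrow> real) \<Rightarrow> bool" where
  "prob_density \<omega> \<longleftrightarrow>
     \<omega> \<in> borel_measurable unit_leb \<and> (\<forall>x\<in>{0..1}. 0 \<le> \<omega> x) \<and> (\<integral>x. \<omega> x \<partial>unit_leb) = 1"

text \<open>
  Densities are elements of \<open>L\<^sup>1\<close>: different points of the support have to differ on a set of
  positive measure. Otherwise countably many versions of a single density would count as an
  infinite support.
\<close>

definition distribution_on_densities :: "(real \<Rightarrow> real) pmf \<Rightarrow> bool" where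
  "distribution_on_densities q \<longleftrightarrow>
     (\<forall>\<sigma>\<in>set_pmf q. prob_density \<sigma>) \<and>
     (\<forall>\<sigma>\<in>set_pmf q. \<forall>\<tau>\<in>set_pmf q. (AE x in unit_leb. \<sigma> x = \<tau> x) \<longrightarrow> \<sigma> = \<tau>)"

definition test :: "nat \<Rightarrow> ((nat \<Rightarrow> real) \<Rightarrow> real) \<Rightarrow> bool" where
  "test n T \<longleftrightarrow> T \<in> borel_measurable (cube n) \<and> (\<forall>x\<in>space (cube n). 0 \<le> T x \<and> T x \<le> 1)"

definition prod_value :: "(real \<Rightarrow> real) \<Rightarrow> nat \<Rightarrow> ((nat \<Rightarrow> real) \<Rightarrow> real) \<Rightarrow> real" where
  "prod_value \<omega> n T = (\<integral>x. (\<Prod>i<n. \<omega> (x i)) * T x \<partial>cube n)"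

definition type1_error :: "(real \<Rightarrow> real) \<Rightarrow> nat \<Rightarrow> ((nat \<Rightarrow> real) \<Rightarrow> real) \<Rightarrow> real" where
  "type1_error \<rho> n T = prod_value \<rho> n (\<lambda>x. 1 - T x)"

definition type2_simple :: "(real \<Rightarrow> real) \<Rightarrow> nat \<Rightarrow> ((nat \<Rightarrow> real) \<Rightarrow> real) \<Rightarrow> real" where
  "type2_simple \<sigma> n T = prod_value \<sigma> n T"

definition type2_mixture :: "(real \<Rightarrow> real) pmf \<Rightarrow> nat \<Rightarrow> ((nat \<Rightarrow> real) \<Rightarrow> real) \<Rightarrow> real" where
  "type2_mixture q n T = (\<Sum>\<^sub>\<infinity>\<sigma>\<in>set_pmf q. pmf q \<sigma> * prod_value \<sigma> n T)"

definition type2_composite :: "(real \<Rightarrow> real) set \<Rightarrow> nat \<Rightarrow> ((nat \<Rightarrow> real) \<Rightarrow> real) \<Rightarrow> real" where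
  "type2_composite S n T = (SUP \<sigma>\<in>S. prod_value \<sigma> n T)"

text \<open>\<open>- (1/n) log p\<close> with \<open>- log 0 = \<infinity>\<close>; the value at \<open>n = 0\<close> is irrelevant for the limits.\<close>

definition rate :: "nat \<Rightarrow> real \<Rightarrow> ereal" where
  "rate n p = (if p = 0 then \<infinity> else ereal (- (1 / real n) * ln p))"

definition exponent :: "(nat \<Rightarrow> real) \<Rightarrow> ereal" where
  "exponent p = liminf (\<lambda>n. rate n (p n))"

text \<open>
  The error exponents of a testing problem are taken relative to its type II error
  \<open>\<beta>\<close>, which maps the number of samples and a test to a real number.
\<close>

definition stein_exp ::
  "(real \<Rightarrow> real) \<Rightarrow> (nat \<Rightarrow> ((nat \<Rightarrow> real) \<Rightarrow> real) \<Rightarrow> real) \<Rightarrow> ereal" where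
  "stein_exp \<rho> \<beta> =
     (SUP T\<in>{T. (\<forall>n. test n (T n)) \<and> (\<lambda>n. type1_error \<rho> n (T n)) \<longlonglongrightarrow> 0}.
        exponent (\<lambda>n. \<beta> n (T n)))"

definition direct_exp ::
  "real \<Rightarrow> (real \<Rightarrow> real) \<Rightarrow> (nat \<Rightarrow> ((nat \<Rightarrow> real) \<Rightarrow> real) \<Rightarrow> real) \<Rightarrow> ereal" where
  "direct_exp r \<rho> \<beta> =
     (SUP T\<in>{T. (\<forall>n. test n (T n)) \<and> exponent (\<lambda>n. \<beta> n (T n)) \<ge> ereal r}.
        exponent (\<lambda>n. type1_error \<rho> n (T n)))"

definition chernoff_exp ::
  "(real \<Rightarrow> real) \<Rightarrow> (nat \<Rightarrow> ((nat \<Rightarrow> real) \<Rightarrow> real) \<Rightarrow> real) \<Rightarrow> ereal" where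
  "chernoff_exp \<rho> \<beta> =
     (SUP r\<in>{r. 0 \<le> r \<and> (\<exists>T. (\<forall>n. test n (T n)) \<and>
          exponent (\<lambda>n. type1_error \<rho> n (T n)) \<ge> ereal r \<and>
          exponent (\<lambda>n. \<beta> n (T n)) \<ge> ereal r)}. ereal r)"

end

theory Submission
  imports Defs "HOL-Real_Asymp.Real_Asymp"
begin

text \<open>
  Let \<open>\<rho>\<close> be uniform, \<open>\<sigma>\<^sub>k\<close> uniform on the set where the \<open>k\<close>-th binary digit vanishes, and
  \<open>q\<close> give it the weight \<open>1 / ((k + 1) (k + 2))\<close>. The likelihoods of the \<open>\<sigma>\<^sub>k\<^sup>\<otimes>\<^sup>n\<close> with respect to
  \<open>\<rho>\<^sup>\<otimes>\<^sup>n\<close> are pairwise uncorrelated, have mean 1 and take only the values 0 and \<open>2\<^sup>n\<close>.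

  A single \<open>\<sigma>\<^sub>k\<close> is excluded without type II error as soon as one sample lies outside its support,
  which fails with probability \<open>2\<^sup>-\<^sup>n\<close>: the Stein exponent is infinite, the others at least \<open>ln 2\<close>.
  The average of the first \<open>K\<close> likelihoods tends to 1 in \<open>L\<^sup>2\<close> as \<open>K\<close> grows, so the worst \<open>\<sigma>\<^sub>k\<close> cannot be
  told apart from \<open>\<rho>\<close> and all composite exponents vanish.

  For the mixture, \<open>K = 16 * 2\<^sup>n\<close> terms already suffice for that average, and their weights are of
  order at least \<open>4\<^sup>-\<^sup>n\<close>, so the Stein exponent is at most \<open>ln 2\<close>. Excluding the \<open>\<sigma>\<^sub>k\<close> with
  \<open>k < exp (r n)\<close> costs a type I error \<open>exp (r n) 2\<^sup>-\<^sup>n\<close> and leaves a type II error \<open>exp (- r n)\<close>, the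
  remaining weight. Conversely, a type II exponent \<open>r\<close> forces
  the test to reject on most of the support of each of \<open>K = exp (b n)\<close> many \<open>\<sigma>\<^sub>k\<close>, for some \<open>b > 0\<close>; these
  supports hardly overlap, so the type I error is at least of order \<open>K 2\<^sup>-\<^sup>n\<close>.
\<close>

section \<open>Binary digit densities\<close>

abbreviation uniform :: "real \<Rightarrow> real" where
  "uniform \<equiv> \<lambda>_. 1"

text \<open>The condition says that the digit of \<open>x\<close> of value \<open>2\<^sup>-\<^sup>k\<^sup>-\<^sup>1\<close> is 0.\<close>

definition half_density :: "nat \<Rightarrow> real \<Rightarrow> real" where
  "half_density k x = (if even \<lfloor>2 ^ Suc k * x\<rfloor> then 2 else 0)"

definition likelihood :: "nat \<Rightarrow> nat \<Rightarrow> (nat \<Rightarrow> real) \<Rightarrow> real" where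
  "likelihood n k x = (\<Prod>i<n. half_density k (x i))"

lemma space_unit_leb [simp]: "space unit_leb = {0..1}"
  by (simp add: unit_leb_def space_restrict_space)

lemma borel_measurable_unit_leb: "f \<in> borel_measurable borel \<Longrightarrow> f \<in> borel_measurable unit_leb"
  unfolding unit_leb_def by (rule measurable_restrict_space1) simp

lemma half_density_borel [measurable]: "half_density k \<in> borel_measurable borel"
  unfolding half_density_def by measurable

lemma half_density_measurable [measurable]: "half_density k \<in> borel_measurable unit_leb"
  by (rule borel_measurable_unit_leb) measurable

lemma half_density_nonneg [simp]: "0 \<le> half_density k x"
  and half_density_le [simp]: "half_density k x \<le> 2"
  by (simp_all add: half_density_def)

interpretation unit_leb: prob_space unit_leb
proof
  have "emeasure unit_leb (space unit_leb) = emeasure lborel {0..1::real}"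
    unfolding unit_leb_def by (subst emeasure_restrict_space) (auto simp: space_restrict_space)
  then show "emeasure unit_leb (space unit_leb) = 1" by simp
qed

section \<open>Integrals of binary digits over the unit interval\<close>

lemma integral_unit_leb:
  fixes f :: "real \<Rightarrow> real"
  shows "(\<integral>x. f x \<partial>unit_leb) = (\<integral>x. indicator {0..1} x * f x \<partial>lborel)"
  unfolding unit_leb_def by (subst integral_restrict_space) auto

text \<open>Cutting the interval at 1/2 and rescaling both halves strips the leading binary digit.
  This drives all inductions on digit positions.\<close>

lemma integral_doubling:
  fixes f :: "real \<Rightarrow> real"
  assumes [measurable]: "f \<in> borel_measurable borel" and B: "\<And>x. \<bar>f x\<bar> \<le> B"
  shows "(\<integral>x. f x \<partial>unit_leb) =
    ((\<integral>x. f (x / 2) \<partial>unit_leb) + (\<integral>x. f ((x + 1) / 2) \<partial>unit_leb)) / 2"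
proof -
  have int: "integrable lborel (\<lambda>x. indicator S x * f x)"
    if "S \<in> sets borel" "S \<subseteq> {0..1}" for S
  proof (rule Bochner_Integration.integrable_bound)
    show "integrable lborel (\<lambda>x. B * indicator {0..1::real} x)" by simp
    show "AE x in lborel. norm (indicator S x * f x) \<le> norm (B * indicator {0..1} x)"
      using that B by (auto simp: indicator_def intro!: AE_I2 order_trans[OF B])
    show "(\<lambda>x. indicator S x * f x) \<in> borel_measurable lborel"
      using that by measurable
  qed
  have "(\<integral>x. f x \<partial>unit_leb) =
      (\<integral>x. indicator {0..1/2} x * f x + indicator {1/2<..1} x * f x \<partial>lborel)"
    unfolding integral_unit_leb
    by (intro Bochner_Integration.integral_cong) (auto simp: indicator_def)
  also have "\<dots> = (\<integral>x. indicator {0..1/2} x * f x \<partial>lborel) + (\<integral>x. indicator {1/2<..1} x * f x \<partial>lborel)"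
    by (intro Bochner_Integration.integral_add int) auto
  also have "(\<integral>x. indicator {0..1/2} x * f x \<partial>lborel) = (\<integral>x. f (x / 2) \<partial>unit_leb) / 2"
    unfolding integral_unit_leb
    by (subst lborel_integral_real_affine[where c = "1/2" and t = 0])
       (auto intro!: Bochner_Integration.integral_cong simp: indicator_def)
  also have "(\<integral>x. indicator {1/2<..1} x * f x \<partial>lborel) = (\<integral>x. f ((x + 1) / 2) \<partial>unit_leb) / 2"
  proof -
    \<comment> \<open>The substitution turns the half-open interval into the one from 0 to 1 without
      0, so the integrands differ at most at \<open>x = 0\<close>.\<close>
    have "AE x in lborel. x \<noteq> (0::real)" by (rule AE_lborel_singleton)
    then have "(\<integral>x. indicator {1/2<..1} (1/2 + 1/2 * x) * f (1/2 + 1/2 * x) \<partial>lborel) =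
        (\<integral>x. indicator {0..1} x * f ((x + 1) / 2) \<partial>lborel)"
      by (intro integral_cong_AE) (auto simp: indicator_def field_simps)
    then show ?thesis
      unfolding integral_unit_leb
      by (subst lborel_integral_real_affine[where c = "1/2" and t = "1/2"]) simp_all
  qed
  finally show ?thesis by simp
qed

text \<open>Halving moves each digit one place to the right. With the periodicity below, digit
  \<open>Suc k\<close> on either half of the interval becomes digit \<open>k\<close> of the rescaled
  point.\<close>

lemma half_density_Suc: "half_density (Suc k) (x / 2) = half_density k x"
  by (simp add: half_density_def ac_simps)

lemma half_density_add_1: "half_density k (x + 1) = half_density k x"
proof -
  \<comment> \<open>The shift adds an even integer, which keeps the parity of the floor.\<close>
  have "2 ^ Suc k * (x + 1) = 2 ^ Suc k * x + of_int (2 ^ Suc k)"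
    by (simp add: field_simps)
  then have "\<lfloor>2 ^ Suc k * (x + 1)\<rfloor> = \<lfloor>2 ^ Suc k * x\<rfloor> + 2 ^ Suc k"
    by (simp only: floor_add_int)
  then show ?thesis
    by (simp add: half_density_def)
qed

text \<open>Both equations fail at \<open>x = 1\<close>, hence the strict bound here and the
  almost-everywhere arguments below.\<close>

lemma half_density_0:
  assumes "0 \<le> x" "x < 1"
  shows "half_density 0 (x / 2) = 2" "half_density 0 ((x + 1) / 2) = 0"
proof -
  have double: "2 ^ Suc 0 * (y / 2) = y" for y :: real by simp
  have "\<lfloor>x\<rfloor> = 0" "\<lfloor>x + 1\<rfloor> = 1" using assms by (auto simp: floor_eq_iff)
  then show "half_density 0 (x / 2) = 2" "half_density 0 ((x + 1) / 2) = 0"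
    by (simp_all only: half_density_def double) simp_all
qed

lemma AE_unit_leb_less_1: "AE x in unit_leb. 0 \<le> x \<and> x < 1"
proof -
  have "AE x in lborel. x \<noteq> (1::real)" by (rule AE_lborel_singleton)
  then show ?thesis
    unfolding unit_leb_def by (subst AE_restrict_space_iff) auto
qed

text \<open>The density doubles the left half and deletes the right one, so only the rescaled left
  half contributes.\<close>

lemma integral_half_density_0_times:
  fixes g :: "real \<Rightarrow> real"
  assumes [measurable]: "g \<in> borel_measurable borel" and B: "\<And>x. \<bar>g x\<bar> \<le> B"
  shows "(\<integral>x. half_density 0 x * g x \<partial>unit_leb) = (\<integral>x. g (x / 2) \<partial>unit_leb)"
proof -
  have [measurable]: "(\<lambda>x. g (x / 2)) \<in> borel_measurable unit_leb"
    "(\<lambda>x. g ((x + 1) / 2)) \<in> borel_measurable unit_leb"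
    "(\<lambda>x. half_density 0 (x / 2)) \<in> borel_measurable unit_leb"
    "(\<lambda>x. half_density 0 ((x + 1) / 2)) \<in> borel_measurable unit_leb"
    by (rule borel_measurable_unit_leb; measurable)+
  have "\<bar>half_density 0 x * g x\<bar> \<le> 2 * B" for x
    unfolding abs_mult using B[of x] by (intro mult_mono) auto
  then have "(\<integral>x. half_density 0 x * g x \<partial>unit_leb) =
      ((\<integral>x. half_density 0 (x / 2) * g (x / 2) \<partial>unit_leb) +
       (\<integral>x. half_density 0 ((x + 1) / 2) * g ((x + 1) / 2) \<partial>unit_leb)) / 2"
    by (intro integral_doubling[where B = "2 * B"]) auto
  also have "(\<integral>x. half_density 0 (x / 2) * g (x / 2) \<partial>unit_leb) = (\<integral>x. 2 * g (x / 2) \<partial>unit_leb)"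
    using AE_unit_leb_less_1 by (intro integral_cong_AE) (auto simp: half_density_0)
  also have "(\<integral>x. half_density 0 ((x + 1) / 2) * g ((x + 1) / 2) \<partial>unit_leb) = (\<integral>x. 0 \<partial>unit_leb)"
    using AE_unit_leb_less_1 by (intro integral_cong_AE) (auto simp: half_density_0)
  finally show ?thesis by simp
qed

lemma integral_half_density: "(\<integral>x. half_density k x \<partial>unit_leb) = 1"
proof (induction k)
  case 0
  show ?case using integral_half_density_0_times[of "\<lambda>_. 1" 1] unit_leb.prob_space by simp
next
  case (Suc k)
  show ?case
    by (subst integral_doubling[where B = 2]) (auto simp: half_density_Suc half_density_add_1 Suc.IH)
qed

lemma half_density_square: "half_density k x * half_density k x = 2 * half_density k x"
  by (simp add: half_density_def)

text \<open>Distinct binary digits are independent. Doubling lowers both indices until the smaller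
  one is 0; that factor then restricts to the left half, where the other factor has mean 1.\<close>

lemma integral_half_density_mult_less:
  "j < k \<Longrightarrow> (\<integral>x. half_density j x * half_density k x \<partial>unit_leb) = 1"
proof (induction j arbitrary: k)
  case 0
  then obtain k' where "k = Suc k'" by (cases k) auto
  then show ?case
    by (subst integral_half_density_0_times[where B = 2]) (auto simp: half_density_Suc integral_half_density)
next
  case (Suc j)
  then obtain k' where k: "k = Suc k'" "j < k'" by (cases k) auto
  have "\<bar>half_density (Suc j) x * half_density k x\<bar> \<le> 2 * 2" for x
    unfolding abs_mult by (intro mult_mono) auto
  then show ?case using k Suc.IH
    by (subst integral_doubling[where B = "2 * 2"]) (auto simp: half_density_Suc half_density_add_1)
qed

lemma integral_half_density_mult:
  "(\<integral>x. half_density j x * half_density k x \<partial>unit_leb) = (if j = k then 2 else 1)"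
proof (cases j k rule: linorder_cases)
  case equal
  then show ?thesis by (simp add: half_density_square integral_half_density)
next
  case greater
  then show ?thesis using integral_half_density_mult_less[of k j] by (simp add: mult.commute)
qed (simp add: integral_half_density_mult_less)

text \<open>Versions of one density would have the mixed second moment 2, while distinct indices
  give 1.\<close>

lemma half_density_AE_eq_imp_eq:
  assumes "AE x in unit_leb. half_density j x = half_density k x"
  shows "j = k"
proof -
  have "(\<integral>x. half_density j x * half_density k x \<partial>unit_leb) =
      (\<integral>x. half_density k x * half_density k x \<partial>unit_leb)"
    using assms by (intro integral_cong_AE) auto
  then show ?thesis by (simp add: integral_half_density_mult split: if_splits)
qed

lemma inj_half_density: "inj half_density"
  by (intro injI half_density_AE_eq_imp_eq) simp

lemma prob_density_half_density: "prob_density (half_density k)"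
  by (simp add: prob_density_def integral_half_density)

lemma prob_density_uniform: "prob_density uniform"
  using unit_leb.prob_space by (simp add: prob_density_def)

section \<open>Product likelihoods and tests on the cube\<close>

interpretation unit_product: product_sigma_finite "\<lambda>_. unit_leb"
  by unfold_locales

interpretation cube: prob_space "cube n" for n
  unfolding cube_def by (rule prob_space_PiM) unfold_locales

lemma likelihood_measurable [measurable]: "likelihood n k \<in> borel_measurable (cube n)"
  unfolding likelihood_def cube_def by measurable

lemma likelihood_nonneg [simp]: "0 \<le> likelihood n k x"
  unfolding likelihood_def by (intro prod_nonneg) auto

lemma likelihood_le: "likelihood n k x \<le> 2 ^ n"
  using prod_mono[of "{..<n}" "\<lambda>i. half_density k (x i)" "\<lambda>_. 2"] by (simp add: likelihood_def)

lemma likelihood_cases: "likelihood n k x = 0 \<or> likelihood n k x = 2 ^ n"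
proof (cases "\<exists>i<n. half_density k (x i) = 0")
  case True
  then show ?thesis by (auto simp: likelihood_def)
next
  case False
  then have "half_density k (x i) = 2" if "i < n" for i
    using that by (auto simp: half_density_def split: if_splits)
  then show ?thesis by (simp add: likelihood_def)
qed

lemma integrable_half_density_mult [simp]:
  "integrable unit_leb (\<lambda>x. half_density j x * half_density k x)"
proof (rule unit_leb.integrable_const_bound[where B = "2 * 2"])
  have "\<bar>half_density j x * half_density k x\<bar> \<le> 2 * 2" for x
    unfolding abs_mult by (intro mult_mono) auto
  then show "AE x in unit_leb. norm (half_density j x * half_density k x) \<le> 2 * 2" by simp
qed measurable

lemma integral_likelihood: "(\<integral>x. likelihood n k x \<partial>cube n) = 1"
proof -
  have "integrable unit_leb (half_density k)"
    by (rule unit_leb.integrable_const_bound[where B = 2]) auto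
  then show ?thesis
    unfolding likelihood_def cube_def
    by (subst unit_product.product_integral_prod) (auto simp: integral_half_density)
qed

text \<open>The integral factorizes over the coordinates. Since the means are 1, distinct
  likelihoods have covariance 0 and each has variance \<open>2 ^ n - 1\<close>.\<close>

lemma integral_likelihood_mult:
  "(\<integral>x. likelihood n j x * likelihood n k x \<partial>cube n) = (if j = k then 2 ^ n else 1)"
  unfolding likelihood_def cube_def prod.distrib[symmetric]
  by (subst unit_product.product_integral_prod) (auto simp: integral_half_density_mult)

lemma integrable_cube_bounded:
  fixes f :: "(nat \<Rightarrow> real) \<Rightarrow> real"
  assumes "f \<in> borel_measurable (cube n)" "\<And>x. x \<in> space (cube n) \<Longrightarrow> \<bar>f x\<bar> \<le> B"
  shows "integrable (cube n) f"
  using assms by (intro cube.integrable_const_bound[where B = B]) auto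

lemma prod_value_uniform: "prod_value uniform n T = (\<integral>x. T x \<partial>cube n)"
  by (simp add: prod_value_def)

lemma prod_value_half_density:
  "prod_value (half_density k) n T = (\<integral>x. likelihood n k x * T x \<partial>cube n)"
  by (simp add: prod_value_def likelihood_def)

lemma test_measurable: "test n T \<Longrightarrow> T \<in> borel_measurable (cube n)"
  and test_nonneg: "test n T \<Longrightarrow> x \<in> space (cube n) \<Longrightarrow> 0 \<le> T x"
  and test_le_1: "test n T \<Longrightarrow> x \<in> space (cube n) \<Longrightarrow> T x \<le> 1"
  by (auto simp: test_def)

lemma integrable_test:
  assumes "test n T"
  shows "integrable (cube n) T" "integrable (cube n) (\<lambda>x. likelihood n k x * T x)"
    "integrable (cube n) (likelihood n k)"
proof -
  note [measurable] = test_measurable[OF assms]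
  show "integrable (cube n) T"
    using test_nonneg[OF assms] test_le_1[OF assms]
    by (intro integrable_cube_bounded[where B = 1]) auto
  show "integrable (cube n) (likelihood n k)"
    by (intro integrable_cube_bounded[where B = "2 ^ n"]) (auto simp: likelihood_le)
  have "\<bar>likelihood n k x * T x\<bar> \<le> 2 ^ n * 1" if "x \<in> space (cube n)" for x
    unfolding abs_mult using test_nonneg[OF assms that] test_le_1[OF assms that]
    by (intro mult_mono) (auto simp: likelihood_le)
  then show "integrable (cube n) (\<lambda>x. likelihood n k x * T x)"
    by (intro integrable_cube_bounded) auto
qed

lemma type1_error_uniform:
  assumes "test n T"
  shows "type1_error uniform n T = 1 - (\<integral>x. T x \<partial>cube n)"
  unfolding type1_error_def prod_value_uniform
  using integrable_test(1)[OF assms] by (simp add: cube.prob_space)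

lemma type1_error_nonneg:
  assumes "test n T"
  shows "0 \<le> type1_error uniform n T"
  unfolding type1_error_def prod_value_uniform
  using test_le_1[OF assms] by (intro integral_nonneg_AE AE_I2) auto

lemma prod_value_nonneg:
  assumes "test n T"
  shows "0 \<le> prod_value (half_density k) n T"
  unfolding prod_value_half_density
  using test_nonneg[OF assms] by (intro integral_nonneg_AE AE_I2) auto

lemma prod_value_le_1:
  assumes "test n T"
  shows "prod_value (half_density k) n T \<le> 1"
proof -
  have "prod_value (half_density k) n T \<le> (\<integral>x. likelihood n k x \<partial>cube n)"
    unfolding prod_value_half_density
    using test_le_1[OF assms]
    by (intro integral_mono integrable_test[OF assms]) (auto simp: mult_left_le)
  then show ?thesis by (simp add: integral_likelihood)
qed

section \<open>Second-moment bounds on the two errors\<close>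

definition likelihood_sum :: "nat \<Rightarrow> nat \<Rightarrow> (nat \<Rightarrow> real) \<Rightarrow> real" where
  "likelihood_sum n K x = (\<Sum>k<K. likelihood n k x)"

lemma integrable_likelihood_mult: "integrable (cube n) (\<lambda>x. likelihood n j x * likelihood n k x)"
proof -
  have "\<bar>likelihood n j x * likelihood n k x\<bar> \<le> 2 ^ n * 2 ^ n" for x
    unfolding abs_mult by (intro mult_mono) (auto simp: likelihood_le)
  then show ?thesis by (intro integrable_cube_bounded) auto
qed

text \<open>The \<open>K\<close> diagonal products have mean \<open>2 ^ n\<close>, the
  \<open>K * (K - 1)\<close> others have mean 1.\<close>

lemma integral_likelihood_sum_square:
  "integrable (cube n) (\<lambda>x. (likelihood_sum n K x)\<^sup>2)"
  "(\<integral>x. (likelihood_sum n K x)\<^sup>2 \<partial>cube n) = real K * 2 ^ n + real K * (real K - 1)"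
proof -
  have eq: "(likelihood_sum n K x)\<^sup>2 = (\<Sum>j<K. \<Sum>k<K. likelihood n j x * likelihood n k x)" for x
    by (simp add: likelihood_sum_def power2_eq_square sum_product)
  show "integrable (cube n) (\<lambda>x. (likelihood_sum n K x)\<^sup>2)"
    unfolding eq by (intro Bochner_Integration.integrable_sum integrable_likelihood_mult)
  have "(\<integral>x. (likelihood_sum n K x)\<^sup>2 \<partial>cube n) =
      (\<Sum>j<K. \<Sum>k<K. \<integral>x. likelihood n j x * likelihood n k x \<partial>cube n)"
    unfolding eq
    by (subst Bochner_Integration.integral_sum; (intro sum.cong Bochner_Integration.integrable_sum
          integrable_likelihood_mult refl Bochner_Integration.integral_sum)?)
  also have "\<dots> = (\<Sum>j<K. \<Sum>k<K. 1 + (if j = k then 2 ^ n - 1 else 0))"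
    by (intro sum.cong refl) (simp add: integral_likelihood_mult)
  also have "\<dots> = real K * 2 ^ n + real K * (real K - 1)"
    by (simp add: sum.distrib algebra_simps)
  finally show "(\<integral>x. (likelihood_sum n K x)\<^sup>2 \<partial>cube n) = real K * 2 ^ n + real K * (real K - 1)" .
qed

lemma integral_likelihood_sum_test:
  assumes "test n T"
  shows "integrable (cube n) (\<lambda>x. likelihood_sum n K x * T x)"
    "(\<integral>x. likelihood_sum n K x * T x \<partial>cube n) = (\<Sum>k<K. prod_value (half_density k) n T)"
  unfolding likelihood_sum_def sum_distrib_right prod_value_half_density
  by (auto intro!: Bochner_Integration.integral_sum integrable_test[OF assms])

lemma test_one: "test n (\<lambda>_. 1)"
  and test_zero: "test n (\<lambda>_. 0)"
  by (auto simp: test_def)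

lemma test_complement: "test n T \<Longrightarrow> test n (\<lambda>x. 1 - T x)"
  by (auto simp: test_def)

lemma integral_likelihood_sum:
  "integrable (cube n) (likelihood_sum n K)" "(\<integral>x. likelihood_sum n K x \<partial>cube n) = real K"
  using integral_likelihood_sum_test[OF test_one, of n K]
  by (simp_all add: prod_value_half_density integral_likelihood)

text \<open>A Chebyshev-type estimate: the average likelihood deviates from 1 in mean by at most
  \<open>\<delta>\<close> plus its variance over \<open>\<delta>\<close>, and the variance is below
  \<open>2 ^ n / K\<close>. A test with values between 0 and 1 loses no more than that.\<close>

lemma sum_prod_value_ge:
  assumes T: "test n T" and "0 < K" "0 < \<delta>"
  shows "(\<Sum>k<K. prod_value (half_density k) n T) \<ge>
    real K * (1 - type1_error uniform n T - \<delta> - 2 ^ n / (real K * \<delta>))"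
proof -
  \<comment> \<open>Deviations up to \<open>c\<close> are charged in full, larger ones through their
    square; after division by \<open>K\<close> the first charge is \<open>\<delta>\<close>.\<close>
  define c where "c = \<delta> * real K"
  have c: "0 < c" using assms by (simp add: c_def)
  let ?f = "likelihood_sum n K"
  have square: "integrable (cube n) (\<lambda>x. (?f x - real K)\<^sup>2)"
    "(\<integral>x. (?f x - real K)\<^sup>2 \<partial>cube n) = real K * 2 ^ n - real K"
    using integral_likelihood_sum integral_likelihood_sum_square[of n K]
    by (simp_all add: power2_diff cube.prob_space power2_eq_square algebra_simps)
  have "(\<integral>x. real K * T x - c - (?f x - real K)\<^sup>2 / c \<partial>cube n) \<le> (\<integral>x. ?f x * T x \<partial>cube n)"
  proof (intro integral_mono)
    fix x assume x: "x \<in> space (cube n)"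
    let ?y = "?f x - real K"
    have "\<bar>?y * T x\<bar> \<le> \<bar>?y\<bar>"
      using test_nonneg[OF T x] test_le_1[OF T x] by (simp add: abs_mult mult_left_le)
    moreover have "c * \<bar>?y\<bar> \<le> c\<^sup>2 + ?y\<^sup>2"
      using sum_squares_bound[of c "\<bar>?y\<bar>"] c by (simp add: mult.assoc) (smt (verit) mult_nonneg_nonneg)
    then have "\<bar>?y\<bar> \<le> c + ?y\<^sup>2 / c"
      using c by (simp add: field_simps power2_eq_square)
    moreover have "real K * T x - ?f x * T x = - (?y * T x)" by (simp add: algebra_simps)
    ultimately show "real K * T x - c - (?f x - real K)\<^sup>2 / c \<le> ?f x * T x" by linarith
  qed (use square(1) integrable_test(1)[OF T] integral_likelihood_sum_test(1)[OF T] in auto)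
  also have "(\<integral>x. real K * T x - c - (?f x - real K)\<^sup>2 / c \<partial>cube n) =
      real K * (\<integral>x. T x \<partial>cube n) - c - (real K * 2 ^ n - real K) / c"
    using square integrable_test(1)[OF T] by (simp add: cube.prob_space)
  finally have "real K * (\<integral>x. T x \<partial>cube n) - c - (real K * 2 ^ n - real K) / c
      \<le> (\<Sum>k<K. prod_value (half_density k) n T)"
    by (simp add: integral_likelihood_sum_test[OF T])
  moreover have "(real K * 2 ^ n - real K) / c \<le> 2 ^ n / \<delta>"
    using assms by (simp add: c_def field_simps)
  ultimately show ?thesis
    using assms by (simp add: type1_error_uniform[OF T] c_def field_simps)
qed

text \<open>The rejection function \<open>1 - T\<close> captures at least half of each of the
  \<open>K\<close> alternatives. The second moment keeps their sum from concentrating on a small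
  set, so \<open>1 - T\<close> has a large integral under \<open>uniform\<close> too.\<close>

lemma type1_error_ge:
  assumes T: "test n T" and K: "real K \<le> 2 ^ n"
    and beta: "\<And>k. k < K \<Longrightarrow> prod_value (half_density k) n T \<le> 1 / 2"
  shows "type1_error uniform n T \<ge> real K / (8 * 2 ^ n)"
proof -
  let ?f = "likelihood_sum n K" and ?u = "\<lambda>x. 1 - T x"
  \<comment> \<open>As \<open>K\<close> is at most \<open>2 ^ n\<close>, the second moment is at
    most \<open>2 * K * 2 ^ n\<close>. This \<open>t\<close> makes the quadratic term at most
    \<open>K / 4\<close>, half of the captured mass \<open>K / 2\<close>.\<close>
  define t :: real where "t = 4 * 2 ^ n"
  have t: "0 < t" by (simp add: t_def)
  have u: "test n ?u" by (rule test_complement[OF T])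
  have "prod_value (half_density k) n ?u = 1 - prod_value (half_density k) n T" for k
    using integrable_test[OF T]
    by (simp add: prod_value_half_density right_diff_distrib integral_likelihood)
  then have "(\<Sum>k<K. 1 / 2) \<le> (\<Sum>k<K. prod_value (half_density k) n ?u)"
    using beta by (intro sum_mono) simp
  also have "\<dots> = (\<integral>x. ?f x * ?u x \<partial>cube n)"
    by (simp add: integral_likelihood_sum_test[OF u])
  also have "\<dots> \<le> (\<integral>x. (?f x)\<^sup>2 / (2 * t) + t / 2 * ?u x \<partial>cube n)"
  proof (intro integral_mono)
    fix x assume x: "x \<in> space (cube n)"
    have "2 * ?f x * (t * ?u x) \<le> (?f x)\<^sup>2 + (t * ?u x)\<^sup>2" by (rule sum_squares_bound)
    also have "(t * ?u x)\<^sup>2 = t\<^sup>2 * (?u x * ?u x)" by (simp add: power_mult_distrib power2_eq_square)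
    \<comment> \<open>Values between 0 and 1 do not increase under squaring.\<close>
    also have "\<dots> \<le> t\<^sup>2 * ?u x"
      using test_nonneg[OF T x] test_le_1[OF T x] by (intro mult_left_mono) (auto simp: mult_left_le)
    finally show "?f x * ?u x \<le> (?f x)\<^sup>2 / (2 * t) + t / 2 * ?u x"
      using t by (simp add: field_simps power2_eq_square)
  qed (auto simp del: right_diff_distrib' intro!: integral_likelihood_sum_test(1)[OF u]
      Bochner_Integration.integrable_add integrable_divide integrable_mult_right
      integral_likelihood_sum_square(1) integrable_test(1)[OF u])
  also have "\<dots> = (\<integral>x. (?f x)\<^sup>2 \<partial>cube n) / (2 * t) + t / 2 * (\<integral>x. ?u x \<partial>cube n)"
    using integral_likelihood_sum_square(1)[of n K] integrable_test(1)[OF u] by simp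
  also have "(\<integral>x. ?u x \<partial>cube n) = type1_error uniform n T"
    by (simp add: type1_error_def prod_value_uniform)
  finally have "real K / 2 \<le> (\<integral>x. (?f x)\<^sup>2 \<partial>cube n) / (2 * t) + t / 2 * type1_error uniform n T"
    by simp
  moreover have "(\<integral>x. (?f x)\<^sup>2 \<partial>cube n) \<le> 2 * (real K * 2 ^ n)"
    unfolding integral_likelihood_sum_square(2)
    using mult_left_mono[of "real K - 1" "2 ^ n" "real K"] K by simp
  then have "(\<integral>x. (?f x)\<^sup>2 \<partial>cube n) / (2 * t) \<le> real K / 4"
    by (simp add: t_def field_simps)
  ultimately have "real K / 4 \<le> t / 2 * type1_error uniform n T" by linarith
  then show ?thesis by (simp add: t_def field_simps)
qed

section \<open>Tests that exclude finitely many alternatives\<close>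

definition exclusion_test :: "nat set \<Rightarrow> nat \<Rightarrow> (nat \<Rightarrow> real) \<Rightarrow> real" where
  "exclusion_test F n x = (if \<exists>k\<in>F. likelihood n k x \<noteq> 0 then 0 else 1)"

lemma test_exclusion_test:
  assumes "finite F"
  shows "test n (exclusion_test F n)"
proof -
  \<comment> \<open>Countability of the index set makes the bounded quantifier in the test
    measurable.\<close>
  have "countable F" using assms by (rule countable_finite)
  then show ?thesis unfolding test_def exclusion_test_def by auto
qed

lemma prod_value_exclusion_test: "k \<in> F \<Longrightarrow> prod_value (half_density k) n (exclusion_test F n) = 0"
  unfolding prod_value_half_density
  by (rule integral_eq_zero_AE) (auto simp: exclusion_test_def)

text \<open>A union bound: \<open>uniform\<close> is rejected when the sample lies in the support of
  some excluded product density, and \<open>likelihood n k x / 2 ^ n\<close> is the indicator of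
  that support, with mean \<open>1 / 2 ^ n\<close>.\<close>

lemma type1_error_exclusion_test:
  assumes F: "finite F"
  shows "type1_error uniform n (exclusion_test F n) \<le> real (card F) / 2 ^ n"
proof -
  note T = test_exclusion_test[OF F, of n]
  have "type1_error uniform n (exclusion_test F n) \<le> (\<integral>x. (\<Sum>k\<in>F. likelihood n k x / 2 ^ n) \<partial>cube n)"
    unfolding type1_error_def prod_value_uniform
  proof (intro integral_mono)
    fix x assume "x \<in> space (cube n)"
    show "1 - exclusion_test F n x \<le> (\<Sum>k\<in>F. likelihood n k x / 2 ^ n)"
    proof (cases "\<exists>k\<in>F. likelihood n k x \<noteq> 0")
      case True
      then obtain k where k: "k \<in> F" "likelihood n k x = 2 ^ n" using likelihood_cases by blast
      have "likelihood n k x / 2 ^ n \<le> (\<Sum>k\<in>F. likelihood n k x / 2 ^ n)"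
        using F k(1) by (intro member_le_sum) auto
      then show ?thesis using True k(2) by (auto simp: exclusion_test_def)
    qed (auto simp: exclusion_test_def intro!: sum_nonneg)
  qed (use integrable_test[OF T] in auto)
  also have "\<dots> = (\<Sum>k\<in>F. \<integral>x. likelihood n k x / 2 ^ n \<partial>cube n)"
    by (intro Bochner_Integration.integral_sum) (use integrable_test[OF T] in auto)
  finally show ?thesis by (simp add: integral_likelihood)
qed

section \<open>The mixture and the composite hypothesis\<close>

text \<open>A telescoping sequence, \<open>1 / (k + 1) - 1 / (k + 2)\<close>. Its tail from
  \<open>K\<close> on is \<open>1 / (K + 1)\<close>: polynomial decay, so that exponentially many
  alternatives matter at an exponential scale.\<close>

definition weight :: "nat \<Rightarrow> real" where
  "weight k = 1 / ((real k + 1) * (real k + 2))"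

definition weight_pmf :: "nat pmf" where
  "weight_pmf = embed_pmf weight"

definition density_pmf :: "(real \<Rightarrow> real) pmf" where
  "density_pmf = map_pmf half_density weight_pmf"

lemma weight_pos: "0 < weight k"
  by (simp add: weight_def add_pos_nonneg)

lemma sum_weight: "(\<Sum>k<K. weight k) = 1 - 1 / (real K + 1)"
proof (induction K)
  case (Suc K)
  have "weight K = 1 / (real K + 1) - 1 / (real K + 2)"
    by (simp add: weight_def divide_simps add_eq_0_iff)
  then show ?case using Suc by (simp add: add.commute)
qed simp

lemma weight_sums: "weight sums 1"
  unfolding sums_def sum_weight by real_asymp

lemma pmf_weight_pmf: "pmf weight_pmf k = weight k"
  unfolding weight_pmf_def
proof (rule pmf_embed_pmf)
  show "(\<integral>\<^sup>+ k. ennreal (weight k) \<partial>count_space UNIV) = 1"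
    using weight_sums weight_pos
    by (subst nn_integral_count_space_nat)
       (simp add: suminf_ennreal2 less_imp_le sums_iff)
qed (simp add: weight_pos less_imp_le)

lemma set_density_pmf: "set_pmf density_pmf = range half_density"
proof -
  have "set_pmf weight_pmf = UNIV"
    using weight_pos by (auto simp: set_pmf_eq pmf_weight_pmf less_le)
  then show ?thesis by (simp add: density_pmf_def)
qed

lemma pmf_density_pmf: "pmf density_pmf (half_density k) = weight k"
  by (simp add: density_pmf_def pmf_map_inj' inj_half_density pmf_weight_pmf)

lemma distribution_density_pmf: "distribution_on_densities density_pmf"
  unfolding distribution_on_densities_def set_density_pmf
  using prob_density_half_density half_density_AE_eq_imp_eq by blast

section \<open>Type II error of the mixture\<close>

abbreviation error_term :: "nat \<Rightarrow> ((nat \<Rightarrow> real) \<Rightarrow> real) \<Rightarrow> nat \<Rightarrow> real" where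
  "error_term n T k \<equiv> weight k * prod_value (half_density k) n T"

lemma type2_mixture_density_pmf:
  "type2_mixture density_pmf n T = (\<Sum>\<^sub>\<infinity>k. error_term n T k)"
  unfolding type2_mixture_def set_density_pmf
  using infsum_reindex[OF inj_half_density, of "\<lambda>\<sigma>. pmf density_pmf \<sigma> * prod_value \<sigma> n T"]
  by (simp add: o_def pmf_density_pmf)

lemma error_term_nonneg: "test n T \<Longrightarrow> 0 \<le> error_term n T k"
  using weight_pos[of k] prod_value_nonneg[of n T k] by simp

lemma error_term_le: "test n T \<Longrightarrow> error_term n T k \<le> weight k"
  using weight_pos[of k] prod_value_le_1[of n T k] by (intro mult_left_le) simp_all

text \<open>A divergent infinite sum would take the default value 0; domination by
  \<open>weight\<close> rules this out.\<close>

lemma summable_error_term: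
  assumes "test n T"
  shows "error_term n T summable_on UNIV"
proof -
  have nonneg: "norm (error_term n T k) = error_term n T k" for k
    using error_term_nonneg[OF assms, of k] by (simp only: real_norm_def abs_of_nonneg)
  have "summable (error_term n T)"
  proof (rule summable_comparison_test')
    show "summable weight" using weight_sums by (rule sums_summable)
    show "norm (error_term n T k) \<le> weight k" if "0 \<le> k" for k
      unfolding nonneg by (rule error_term_le[OF assms])
  qed
  then show ?thesis by (intro norm_summable_imp_summable_on) (simp only: nonneg)
qed

lemma sum_le_type2_mixture:
  assumes "test n T"
  shows "(\<Sum>k<K. error_term n T k) \<le> type2_mixture density_pmf n T"
  unfolding type2_mixture_density_pmf
  by (intro finite_sum_le_infsum summable_error_term assms error_term_nonneg) auto

lemma type2_mixture_nonneg:
  assumes "test n T"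
  shows "0 \<le> type2_mixture density_pmf n T"
  using sum_le_type2_mixture[OF assms, of 0] by simp

lemma prod_value_le_type2_mixture:
  assumes "test n T"
  shows "weight k * prod_value (half_density k) n T \<le> type2_mixture density_pmf n T"
proof -
  have "error_term n T k \<le> (\<Sum>k<Suc k. error_term n T k)"
    using error_term_nonneg[OF assms] by (intro member_le_sum) auto
  then show ?thesis using sum_le_type2_mixture[OF assms, of "Suc k"] by linarith
qed

text \<open>Excluded alternatives contribute nothing, the others at most their weights, so the tail
  of \<open>weight\<close> is a bound.\<close>

lemma type2_mixture_exclusion_test:
  "type2_mixture density_pmf n (exclusion_test {..<K} n) \<le> 1 / (real K + 1)"
  unfolding type2_mixture_density_pmf
proof (rule infsum_le_finite_sums)
  let ?T = "exclusion_test {..<K} n"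
  have T: "test n ?T" by (simp add: test_exclusion_test)
  show "error_term n ?T summable_on UNIV" by (rule summable_error_term[OF T])
  fix F :: "nat set" assume "finite F"
  then obtain N where N: "F \<subseteq> {..<N}" using finite_nat_bounded by blast
  \<comment> \<open>The maximum ensures that the excluded prefix lies inside the range, so that its
    weights can be subtracted.\<close>
  let ?N = "max K N"
  have "(\<Sum>k\<in>F. error_term n ?T k) \<le> (\<Sum>k<?N. error_term n ?T k)"
    using N by (intro sum_mono2 error_term_nonneg T) auto
  also have "\<dots> \<le> (\<Sum>k<?N. if k < K then 0 else weight k)"
    using error_term_le[OF T] by (intro sum_mono) (auto simp: prod_value_exclusion_test)
  also have "\<dots> = (\<Sum>k\<in>{..<?N} - {..<K}. weight k)"
    by (intro sum.mono_neutral_cong_right) auto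
  also have "\<dots> = (\<Sum>k<?N. weight k) - (\<Sum>k<K. weight k)"
    by (intro sum_diff) auto
  also have "\<dots> \<le> 1 / (real K + 1)" by (simp add: sum_weight)
  finally show "(\<Sum>k\<in>F. error_term n ?T k) \<le> 1 / (real K + 1)" .
qed

lemma exp_minus_ln_2: "exp (- ln 2 * real n) = 1 / 2 ^ n"
  by (simp add: exp_minus exp_of_nat2_mult inverse_eq_divide)

lemma weight_ge:
  assumes "k < K"
  shows "1 / (2 * (real K)\<^sup>2) \<le> weight k"
proof -
  have "(real k + 1) * (real k + 2) \<le> real K * (2 * real K)"
    using assms by (intro mult_mono) auto
  then show ?thesis unfolding weight_def using assms
    by (intro divide_left_mono) (auto simp: power2_eq_square add_pos_nonneg intro!: mult_pos_pos)
qed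

lemma type2_mixture_ge:
  assumes T: "test n T" and alpha: "type1_error uniform n T \<le> 1 / 4"
  shows "1 / 128 * exp (- ln 2 * real n) \<le> type2_mixture density_pmf n T"
proof -
  \<comment> \<open>With \<open>\<delta> = 1/4\<close> this gives
    \<open>2 ^ n / (K * \<delta>) = 1/4\<close>, so the average type II error is at least
    \<open>1 - 3/4\<close>. The weights are at least \<open>1 / (2 * K^2)\<close>, leaving
    \<open>1 / (8 * K)\<close>.\<close>
  define K :: nat where "K = 16 * 2 ^ n"
  have K: "real K = 16 * 2 ^ n" by (simp add: K_def)
  have "real K / 4 \<le> real K * (1 - type1_error uniform n T - 1 / 4 - 2 ^ n / (real K * (1 / 4)))"
    using mult_left_mono[of "1/4" "1 - type1_error uniform n T - 1 / 4 - 2 ^ n / (real K * (1 / 4))" "real K"]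
      alpha by (simp add: K)
  also have "\<dots> \<le> (\<Sum>k<K. prod_value (half_density k) n T)"
    using T by (intro sum_prod_value_ge) (auto simp: K_def)
  finally have sum: "real K / 4 \<le> (\<Sum>k<K. prod_value (half_density k) n T)" .
  have "1 / 128 * exp (- ln 2 * real n) = 1 / (2 * (real K)\<^sup>2) * (real K / 4)"
    unfolding exp_minus_ln_2 by (simp add: K power2_eq_square)
  also have "\<dots> \<le> 1 / (2 * (real K)\<^sup>2) * (\<Sum>k<K. prod_value (half_density k) n T)"
    using sum by (intro mult_left_mono) auto
  also have "\<dots> \<le> (\<Sum>k<K. error_term n T k)"
    unfolding sum_distrib_left
    using weight_ge prod_value_nonneg[OF T] by (intro sum_mono mult_right_mono) auto
  also have "\<dots> \<le> type2_mixture density_pmf n T" by (rule sum_le_type2_mixture[OF T])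
  finally show ?thesis .
qed

section \<open>Type II error of the composite hypothesis\<close>

lemma prod_value_le_type2_composite:
  assumes "test n T"
  shows "prod_value (half_density k) n T \<le> type2_composite (range half_density) n T"
  unfolding type2_composite_def
  using prod_value_le_1[OF assms] by (intro cSUP_upper) (auto simp: bdd_above_def)

text \<open>The supremum dominates the average over the first \<open>K\<close> alternatives, and for
  fixed \<open>n\<close> the loss in that average becomes arbitrarily small as \<open>K\<close>
  grows.\<close>

lemma type2_composite_ge:
  assumes T: "test n T"
  shows "1 - type1_error uniform n T \<le> type2_composite (range half_density) n T"
proof (rule field_le_epsilon)
  fix e :: real assume e: "0 < e"
  define \<delta> where "\<delta> = e / 2"
  have \<delta>: "0 < \<delta>" using e by (simp add: \<delta>_def)
  let ?\<beta> = "type2_composite (range half_density) n T"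
  obtain K :: nat where K: "2 ^ n / \<delta>\<^sup>2 < real K" using reals_Archimedean2 by blast
  have "0 < real K" using K \<delta> by (intro le_less_trans[OF _ K]) auto
  then have "0 < K" by simp
  have "2 ^ n / (real K * \<delta>) \<le> \<delta>"
    using K \<delta> \<open>0 < K\<close> by (simp add: field_simps power2_eq_square)
  then have "real K * (1 - type1_error uniform n T - \<delta> - \<delta>)
      \<le> real K * (1 - type1_error uniform n T - \<delta> - 2 ^ n / (real K * \<delta>))"
    by (intro mult_left_mono) auto
  also have "\<dots> \<le> (\<Sum>k<K. prod_value (half_density k) n T)"
    by (rule sum_prod_value_ge[OF T \<open>0 < K\<close> \<delta>])
  also have "\<dots> \<le> real (card {..<K}) * ?\<beta>"
    by (intro sum_bounded_above prod_value_le_type2_composite[OF T])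
  finally show "1 - type1_error uniform n T \<le> ?\<beta> + e"
    using \<open>0 < K\<close> by (simp add: \<delta>_def)
qed

section \<open>Error exponents\<close>

text \<open>The constant factor changes the rate by \<open>ln c / n\<close>, which vanishes in the
  limit.\<close>

lemma exponent_le:
  assumes "0 < c" and ev: "\<forall>\<^sub>F n in sequentially. c * exp (- a * real n) \<le> p n"
  shows "exponent p \<le> ereal a"
proof -
  have "liminf (\<lambda>n. rate n (p n)) \<le> liminf (\<lambda>n. ereal (a - ln c / real n))"
  proof (rule Liminf_mono)
    show "\<forall>\<^sub>F n in sequentially. rate n (p n) \<le> ereal (a - ln c / real n)"
      using ev eventually_gt_at_top[of 0]
    proof eventually_elim
      case (elim n)
      have pos: "0 < c * exp (- a * real n)" using \<open>0 < c\<close> by simp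
      then have "ln (c * exp (- a * real n)) \<le> ln (p n)" using elim by simp
      then have "ln c - a * real n \<le> ln (p n)" using \<open>0 < c\<close> by (simp add: ln_mult)
      then show ?case using pos elim by (auto simp: rate_def field_simps)
    qed
  qed
  also have "liminf (\<lambda>n. ereal (a - ln c / real n)) = ereal a"
  proof (rule lim_imp_Liminf)
    have "(\<lambda>n. a - ln c / real n) \<longlonglongrightarrow> a" by real_asymp
    then show "(\<lambda>n. ereal (a - ln c / real n)) \<longlonglongrightarrow> ereal a" by simp
  qed simp
  finally show ?thesis by (simp add: exponent_def)
qed

lemma exponent_ge:
  assumes nonneg: "\<And>n. 0 \<le> p n"
    and ev: "\<forall>\<^sub>F n in sequentially. p n \<le> exp (- a * real n)"
  shows "ereal a \<le> exponent p"
  unfolding exponent_def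
proof (rule Liminf_bounded)
  show "\<forall>\<^sub>F n in sequentially. ereal a \<le> rate n (p n)"
    using ev eventually_gt_at_top[of 0]
  proof eventually_elim
    case (elim n)
    show ?case
    proof (cases "p n = 0")
      case False
      then have "0 < p n" using nonneg[of n] by simp
      then have "ln (p n) \<le> - a * real n" using elim by (metis ln_le_cancel_iff ln_exp exp_gt_zero)
      then show ?thesis using False elim by (simp add: rate_def field_simps)
    qed (simp add: rate_def)
  qed
qed

lemma exponent_zero: "exponent (\<lambda>_. 0) = \<infinity>"
  by (simp add: exponent_def rate_def Liminf_const)

text \<open>A limit inferior of at least \<open>r\<close> yields eventual bounds at rates strictly
  below \<open>r\<close>.\<close>

lemma eventually_le_exp_of_exponent:
  assumes "\<And>n. 0 \<le> p n" "ereal r \<le> exponent p" "s < r"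
  shows "\<forall>\<^sub>F n in sequentially. p n \<le> exp (- s * real n)"
proof -
  have "ereal s < exponent p" using assms(2,3) by (metis ereal_less(2) less_ereal.simps(1) less_le_trans)
  then have "\<forall>\<^sub>F n in sequentially. ereal s < rate n (p n)"
    unfolding exponent_def by (rule less_LiminfD)
  then show ?thesis
    using eventually_gt_at_top[of 0]
  proof eventually_elim
    case (elim n)
    show ?case
    proof (cases "p n = 0")
      case False
      then have "0 < p n" using assms(1)[of n] by simp
      moreover have "ln (p n) \<le> - s * real n" using elim False by (simp add: rate_def field_simps)
      ultimately show ?thesis by (metis exp_le_cancel_iff exp_ln)
    qed simp
  qed
qed

lemma stein_exp_ge:
  assumes "\<And>n. test n (T n)" "(\<lambda>n. type1_error \<rho> n (T n)) \<longlonglongrightarrow> 0"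
  shows "exponent (\<lambda>n. \<beta> n (T n)) \<le> stein_exp \<rho> \<beta>"
  unfolding stein_exp_def using assms by (intro SUP_upper) auto

lemma direct_exp_ge:
  assumes "\<And>n. test n (T n)" "ereal r \<le> exponent (\<lambda>n. \<beta> n (T n))"
  shows "exponent (\<lambda>n. type1_error \<rho> n (T n)) \<le> direct_exp r \<rho> \<beta>"
  unfolding direct_exp_def using assms by (intro SUP_upper) auto

lemma chernoff_exp_ge:
  assumes "\<And>n. test n (T n)" "0 \<le> r" "ereal r \<le> exponent (\<lambda>n. type1_error \<rho> n (T n))"
    "ereal r \<le> exponent (\<lambda>n. \<beta> n (T n))"
  shows "ereal r \<le> chernoff_exp \<rho> \<beta>"
  unfolding chernoff_exp_def using assms by (intro SUP_upper) auto

text \<open>An achievable rate above \<open>r\<close> comes from tests admissible for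
  \<open>direct_exp r\<close>, hence is bounded by that exponent.\<close>

lemma chernoff_exp_le:
  assumes "direct_exp r \<rho> \<beta> \<le> ereal s" "r \<le> s"
  shows "chernoff_exp \<rho> \<beta> \<le> ereal s"
  unfolding chernoff_exp_def
proof (rule SUP_least, clarify)
  fix t T assume T: "\<forall>n. test n (T n)" and alpha: "ereal t \<le> exponent (\<lambda>n. type1_error \<rho> n (T n))"
    and beta: "ereal t \<le> exponent (\<lambda>n. \<beta> n (T n))"
  show "ereal t \<le> ereal s"
  proof (cases "t \<le> r")
    case False
    then have "ereal r \<le> exponent (\<lambda>n. \<beta> n (T n))"
      using beta by (intro order_trans[OF _ beta]) simp
    with T have "exponent (\<lambda>n. type1_error \<rho> n (T n)) \<le> direct_exp r \<rho> \<beta>"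
      by (intro direct_exp_ge) auto
    then show ?thesis using alpha assms(1) by (meson order_trans)
  qed (use assms(2) in simp)
qed

section \<open>Exponents of the composite hypothesis\<close>

lemma stein_exp_composite: "stein_exp uniform (type2_composite (range half_density)) \<le> 0"
  unfolding stein_exp_def
proof (rule SUP_least, clarify)
  fix T assume T: "\<forall>n. test n (T n)" and "(\<lambda>n. type1_error uniform n (T n)) \<longlonglongrightarrow> 0"
  then have "\<forall>\<^sub>F n in sequentially. type1_error uniform n (T n) < 1 / 2"
    by (intro order_tendstoD) auto
  then have "\<forall>\<^sub>F n in sequentially.
      1 / 2 * exp (- 0 * real n) \<le> type2_composite (range half_density) n (T n)"
  proof eventually_elim
    case (elim n)
    then show ?case using type2_composite_ge[of n "T n"] T by auto
  qed
  then show "exponent (\<lambda>n. type2_composite (range half_density) n (T n)) \<le> 0"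
    using exponent_le[of "1 / 2" 0] by (simp add: zero_ereal_def)
qed

text \<open>The two errors add up to at least 1, so a decaying type II error keeps the type I error
  above 1/2.\<close>

lemma direct_exp_composite:
  assumes "0 < r"
  shows "direct_exp r uniform (type2_composite (range half_density)) \<le> 0"
  unfolding direct_exp_def
proof (rule SUP_least, clarify)
  fix T assume T: "\<forall>n. test n (T n)"
    and "ereal r \<le> exponent (\<lambda>n. type2_composite (range half_density) n (T n))"
  moreover have "0 \<le> type2_composite (range half_density) n (T n)" for n
    using prod_value_nonneg[of n "T n" 0] prod_value_le_type2_composite[of n "T n" 0] T by fastforce
  ultimately have "\<forall>\<^sub>F n in sequentially.
      type2_composite (range half_density) n (T n) \<le> exp (- (r / 2) * real n)"
    using assms by (intro eventually_le_exp_of_exponent) auto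
  moreover have "\<forall>\<^sub>F n in sequentially. exp (- (r / 2) * real n) \<le> 1 / 2"
    using assms by real_asymp
  ultimately have "\<forall>\<^sub>F n in sequentially. 1 / 2 * exp (- 0 * real n) \<le> type1_error uniform n (T n)"
  proof eventually_elim
    case (elim n)
    then show ?case using type2_composite_ge[of n "T n"] T by auto
  qed
  then show "exponent (\<lambda>n. type1_error uniform n (T n)) \<le> 0"
    using exponent_le[of "1 / 2" 0] by (simp add: zero_ereal_def)
qed

lemma chernoff_exp_composite: "chernoff_exp uniform (type2_composite (range half_density)) \<le> 0"
proof (rule ereal_le_epsilon2)
  fix e :: real assume "0 < e"
  then have "chernoff_exp uniform (type2_composite (range half_density)) \<le> ereal e"
    using direct_exp_composite[of e] by (intro chernoff_exp_le[of e]) (auto intro: order_trans)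
  then show "chernoff_exp uniform (type2_composite (range half_density)) \<le> 0 + ereal e" by simp
qed

lemma tendsto_zero_of_le_exp:
  fixes p :: "nat \<Rightarrow> real"
  assumes "0 < a" "\<And>n. 0 \<le> p n" "\<And>n. p n \<le> exp (- a * real n)"
  shows "p \<longlonglongrightarrow> 0"
proof (rule tendsto_sandwich[of "\<lambda>_. 0" p])
  show "(\<lambda>n. exp (- a * real n)) \<longlonglongrightarrow> 0" using \<open>0 < a\<close> by real_asymp
qed (use assms in auto)

section \<open>Exponents of a single alternative\<close>

lemma exclusion_test_singleton:
  "test n (exclusion_test {k} n)"
  "type2_simple (half_density k) n (exclusion_test {k} n) = 0"
  "type1_error uniform n (exclusion_test {k} n) \<le> exp (- ln 2 * real n)"
  using type1_error_exclusion_test[of "{k}" n]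
  unfolding exp_minus_ln_2
  by (auto simp: test_exclusion_test type2_simple_def prod_value_exclusion_test)

lemma exponent_exclusion_test_singleton:
  "ereal (ln 2) \<le> exponent (\<lambda>n. type1_error uniform n (exclusion_test {k} n))"
  by (intro exponent_ge always_eventually allI exclusion_test_singleton type1_error_nonneg)

lemma stein_exp_simple: "stein_exp uniform (type2_simple (half_density k)) = \<infinity>"
proof -
  have "(\<lambda>n. type1_error uniform n (exclusion_test {k} n)) \<longlonglongrightarrow> 0"
    by (rule tendsto_zero_of_le_exp[of "ln 2"]; (intro exclusion_test_singleton type1_error_nonneg)?)
       simp
  from stein_exp_ge[where \<beta> = "type2_simple (half_density k)", OF exclusion_test_singleton(1) this]
  show ?thesis by (simp add: exclusion_test_singleton exponent_zero)
qed

text \<open>The type II error is exactly 0, so the constraint holds for every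
  \<open>r\<close>.\<close>

lemma direct_exp_simple: "ereal (ln 2) \<le> direct_exp r uniform (type2_simple (half_density k))"
  by (rule order_trans[OF exponent_exclusion_test_singleton[of k] direct_exp_ge])
     (simp_all add: exclusion_test_singleton exponent_zero)

lemma chernoff_exp_simple: "ereal (ln 2) \<le> chernoff_exp uniform (type2_simple (half_density k))"
  by (rule chernoff_exp_ge[of "exclusion_test {k}"])
     (simp_all add: exclusion_test_singleton exponent_zero exponent_exclusion_test_singleton)

section \<open>Exponents of the mixture\<close>

lemma stein_exp_mixture_le: "stein_exp uniform (type2_mixture density_pmf) \<le> ereal (ln 2)"
  unfolding stein_exp_def
proof (rule SUP_least, clarify)
  fix T assume T: "\<forall>n. test n (T n)" and "(\<lambda>n. type1_error uniform n (T n)) \<longlonglongrightarrow> 0"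
  then have "\<forall>\<^sub>F n in sequentially. type1_error uniform n (T n) < 1 / 4"
    by (intro order_tendstoD) auto
  then have "\<forall>\<^sub>F n in sequentially.
      1 / 128 * exp (- ln 2 * real n) \<le> type2_mixture density_pmf n (T n)"
    by eventually_elim (use T in \<open>intro type2_mixture_ge; simp\<close>)
  then show "exponent (\<lambda>n. type2_mixture density_pmf n (T n)) \<le> ereal (ln 2)"
    by (rule exponent_le[rotated]) simp
qed

definition prefix_test :: "real \<Rightarrow> nat \<Rightarrow> (nat \<Rightarrow> real) \<Rightarrow> real" where
  "prefix_test r n = exclusion_test {..<nat \<lfloor>exp (r * real n)\<rfloor>} n"

lemma prefix_test:
  shows test_prefix_test: "test n (prefix_test r n)"
    and type1_error_prefix_test: "type1_error uniform n (prefix_test r n) \<le> exp (- (ln 2 - r) * real n)"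
    and type2_mixture_prefix_test: "type2_mixture density_pmf n (prefix_test r n) \<le> exp (- r * real n)"
proof -
  let ?K = "nat \<lfloor>exp (r * real n)\<rfloor>"
  show "test n (prefix_test r n)" by (simp add: prefix_test_def test_exclusion_test)
  have "0 < exp (r * real n)" by simp
  \<comment> \<open>The floor loses less than 1, which the \<open>+ 1\<close> in the tail bound
    compensates.\<close>
  then have K: "real ?K \<le> exp (r * real n)" "exp (r * real n) \<le> real ?K + 1"
    by linarith+
  have "type1_error uniform n (prefix_test r n) \<le> real ?K * (1 / 2 ^ n)"
    using type1_error_exclusion_test[of "{..<?K}" n] by (simp add: prefix_test_def)
  also have "\<dots> \<le> exp (r * real n) * (1 / 2 ^ n)"
    using K by (intro mult_right_mono) auto
  also have "\<dots> = exp (- (ln 2 - r) * real n)"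
    unfolding exp_minus_ln_2[symmetric] by (simp add: algebra_simps flip: exp_add)
  finally show "type1_error uniform n (prefix_test r n) \<le> exp (- (ln 2 - r) * real n)" .
  have "type2_mixture density_pmf n (prefix_test r n) \<le> 1 / (real ?K + 1)"
    unfolding prefix_test_def by (rule type2_mixture_exclusion_test)
  also have "\<dots> \<le> 1 / exp (r * real n)"
    using K(2) by (intro frac_le) auto
  finally show "type2_mixture density_pmf n (prefix_test r n) \<le> exp (- r * real n)"
    by (simp add: exp_minus inverse_eq_divide)
qed

lemma exponent_prefix_test:
  "ereal (ln 2 - r) \<le> exponent (\<lambda>n. type1_error uniform n (prefix_test r n))"
  "ereal r \<le> exponent (\<lambda>n. type2_mixture density_pmf n (prefix_test r n))"
  by (intro exponent_ge always_eventually allI prefix_test type1_error_nonneg type2_mixture_nonneg)+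

lemma direct_exp_mixture_ge: "ereal (ln 2 - r) \<le> direct_exp r uniform (type2_mixture density_pmf)"
  by (rule order_trans[OF exponent_prefix_test(1) direct_exp_ge])
     (rule test_prefix_test exponent_prefix_test)+

text \<open>At \<open>r = ln 2 / 2\<close> the two guaranteed rates \<open>ln 2 - r\<close> and
  \<open>r\<close> coincide.\<close>

lemma chernoff_exp_mixture_ge: "ereal (ln 2 / 2) \<le> chernoff_exp uniform (type2_mixture density_pmf)"
  using exponent_prefix_test[of "ln 2 / 2"]
  by (intro chernoff_exp_ge[of "prefix_test (ln 2 / 2)"] test_prefix_test) simp_all

lemma stein_exp_mixture_ge: "ereal (ln 2 / 2) \<le> stein_exp uniform (type2_mixture density_pmf)"
proof -
  have "(\<lambda>n. type1_error uniform n (prefix_test (ln 2 / 2) n)) \<longlonglongrightarrow> 0"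
    by (rule tendsto_zero_of_le_exp[OF _ type1_error_nonneg[OF test_prefix_test] type1_error_prefix_test]) simp
  with test_prefix_test
  have "exponent (\<lambda>n. type2_mixture density_pmf n (prefix_test (ln 2 / 2) n))
      \<le> stein_exp uniform (type2_mixture density_pmf)"
    by (rule stein_exp_ge)
  then show ?thesis using exponent_prefix_test(2) by (rule order_trans[rotated])
qed

text \<open>Always rejecting has type II error 0 and type I error 1. This covers large
  \<open>r\<close>, where \<open>ln 2 - r\<close> is negative.\<close>

lemma direct_exp_mixture_nonneg: "0 \<le> direct_exp r uniform (type2_mixture density_pmf)"
proof -
  have "type2_mixture density_pmf n (\<lambda>_. 0) = 0" for n
    by (simp add: type2_mixture_density_pmf prod_value_half_density)
  moreover have "type1_error uniform n (\<lambda>_. 0) = 1" for n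
    by (simp add: type1_error_uniform test_zero)
  ultimately have "exponent (\<lambda>_. 1) \<le> direct_exp r uniform (type2_mixture density_pmf)"
    using direct_exp_ge[of "\<lambda>_ _. 0" r "type2_mixture density_pmf" uniform]
    by (simp add: test_zero exponent_zero)
  moreover have "exponent (\<lambda>_. 1) = 0"
    by (simp add: exponent_def rate_def Liminf_const zero_ereal_def)
  ultimately show ?thesis by simp
qed

text \<open>For \<open>K\<close> about \<open>exp (b * n)\<close> the weights below \<open>K\<close>
  are at least of order \<open>exp (- 2 * b * n)\<close>. A small mixture error then forces each of
  these type II errors below 1/2. The bound \<open>r / 8\<close> makes them decay, the bound
  \<open>ln 2\<close> gives \<open>K \<le> 2 ^ n\<close>.\<close>

lemma direct_exp_mixture_le:
  assumes "0 < r"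
  defines "b \<equiv> min (r / 8) (ln 2)"
  shows "direct_exp r uniform (type2_mixture density_pmf) \<le> ereal (ln 2 - b)"
  unfolding direct_exp_def
proof (rule SUP_least, clarify)
  fix T assume T: "\<forall>n. test n (T n)"
    and "ereal r \<le> exponent (\<lambda>n. type2_mixture density_pmf n (T n))"
  then have "\<forall>\<^sub>F n in sequentially. type2_mixture density_pmf n (T n) \<le> exp (- (r / 2) * real n)"
    using assms by (intro eventually_le_exp_of_exponent[where r = r]) (auto intro: type2_mixture_nonneg)
  moreover have "\<forall>\<^sub>F n in sequentially. 2 * exp (- (r / 4) * real n) \<le> 1 / 2"
    using assms by real_asymp
  ultimately have "\<forall>\<^sub>F n in sequentially. 1 / 16 * exp (- (ln 2 - b) * real n) \<le> type1_error uniform n (T n)"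
  proof eventually_elim
    case (elim n)
    define K where "K = nat \<lfloor>exp (b * real n)\<rfloor>"
    have b: "0 \<le> b" "b \<le> r / 8" "b \<le> ln 2" using assms by (auto simp: b_def)
    then have "1 \<le> exp (b * real n)" by simp
    \<comment> \<open>The floor of a number that is at least 1 is at least half of it.\<close>
    then have "1 \<le> \<lfloor>exp (b * real n)\<rfloor>" by simp
    then have K: "real K \<le> exp (b * real n)" "exp (b * real n) / 2 \<le> real K"
      unfolding K_def by linarith+
    have "real K / (8 * 2 ^ n) \<le> type1_error uniform n (T n)"
    proof (rule type1_error_ge)
      show "test n (T n)" using T by simp
      have "exp (b * real n) \<le> exp (ln 2 * real n)" using b by (simp add: mult_right_mono)
      also have "\<dots> = 2 ^ n" by (simp add: exp_of_nat2_mult)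
      finally show "real K \<le> 2 ^ n" using K by linarith
      fix k assume k: "k < K"
      have "1 / (2 * (real K)\<^sup>2) * prod_value (half_density k) n (T n)
          \<le> weight k * prod_value (half_density k) n (T n)"
        using k T by (intro mult_right_mono weight_ge prod_value_nonneg) auto
      also have "\<dots> \<le> type2_mixture density_pmf n (T n)"
        using T by (intro prod_value_le_type2_mixture) auto
      also have "\<dots> \<le> exp (- (r / 2) * real n)" by (rule elim)
      finally have "prod_value (half_density k) n (T n) \<le> 2 * (real K)\<^sup>2 * exp (- (r / 2) * real n)"
        using k by (simp add: field_simps)
      also have "\<dots> \<le> 2 * (exp (b * real n))\<^sup>2 * exp (- (r / 2) * real n)"
        using K by (intro mult_right_mono mult_left_mono power_mono) auto
      also have "\<dots> = 2 * exp ((2 * b - r / 2) * real n)"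
        by (simp add: power2_eq_square algebra_simps flip: exp_add)
      also have "\<dots> \<le> 2 * exp (- (r / 4) * real n)"
        using b by (intro mult_left_mono exp_mono mult_right_mono) auto
      also have "\<dots> \<le> 1 / 2" by (rule elim)
      finally show "prod_value (half_density k) n (T n) \<le> 1 / 2" .
    qed
    moreover have "1 / 16 * exp (- (ln 2 - b) * real n) = exp (b * real n) / 2 / 8 * exp (- ln 2 * real n)"
      by (simp add: algebra_simps flip: exp_add)
    then have "1 / 16 * exp (- (ln 2 - b) * real n) = exp (b * real n) / 2 / (8 * 2 ^ n)"
      unfolding exp_minus_ln_2 by simp
    moreover have "exp (b * real n) / 2 / (8 * 2 ^ n) \<le> real K / (8 * 2 ^ n)"
      using K(2) by (intro divide_right_mono) auto
    ultimately show ?case by linarith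
  qed
  then show "exponent (\<lambda>n. type1_error uniform n (T n)) \<le> ereal (ln 2 - b)"
    by (rule exponent_le[rotated]) simp
qed

lemma direct_exp_mixture_less:
  assumes "0 < r"
  obtains s where "s < ln 2" "direct_exp r uniform (type2_mixture density_pmf) \<le> ereal s"
  using direct_exp_mixture_le[OF assms] assms by (intro that[of "ln 2 - min (r / 8) (ln 2)"]) auto

text \<open>Any threshold strictly between 0 and \<open>ln 2\<close> serves in the comparison with
  the direct exponent; \<open>ln 2 / 2\<close> is one.\<close>

lemma chernoff_exp_mixture_less: "chernoff_exp uniform (type2_mixture density_pmf) < ereal (ln 2)"
proof -
  obtain s where s: "s < ln 2" "direct_exp (ln 2 / 2) uniform (type2_mixture density_pmf) \<le> ereal s"
    using direct_exp_mixture_less[of "ln 2 / 2"] by auto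
  have "chernoff_exp uniform (type2_mixture density_pmf) \<le> ereal (max s (ln 2 / 2))"
    using s(2) by (intro chernoff_exp_le[of "ln 2 / 2"]) (auto intro: order_trans)
  also have "\<dots> < ereal (ln 2)" using s(1) by simp
  finally show ?thesis .
qed

lemma stein_exp_composite_less:
  "stein_exp uniform (type2_composite (range half_density)) < stein_exp uniform (type2_mixture density_pmf)"
proof (rule le_less_trans[OF stein_exp_composite])
  show "0 < stein_exp uniform (type2_mixture density_pmf)"
    by (rule less_le_trans[OF _ stein_exp_mixture_ge]) simp
qed

lemma chernoff_exp_composite_less:
  "chernoff_exp uniform (type2_composite (range half_density)) < chernoff_exp uniform (type2_mixture density_pmf)"
proof (rule le_less_trans[OF chernoff_exp_composite])
  show "0 < chernoff_exp uniform (type2_mixture density_pmf)"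
    by (rule less_le_trans[OF _ chernoff_exp_mixture_ge]) simp
qed

theorem mainTheorem2:
  shows "\<exists>(\<rho> :: real \<Rightarrow> real) (q :: (real \<Rightarrow> real) pmf).
    prob_density \<rho> \<and> distribution_on_densities q \<and>
    countable (set_pmf q) \<and> infinite (set_pmf q) \<and>
    (stein_exp \<rho> (type2_composite (set_pmf q)) \<le> stein_exp \<rho> (type2_mixture q) \<and>
     stein_exp \<rho> (type2_mixture q) < (INF \<sigma>\<in>set_pmf q. stein_exp \<rho> (type2_simple \<sigma>))) \<and>
    (chernoff_exp \<rho> (type2_composite (set_pmf q)) \<le> chernoff_exp \<rho> (type2_mixture q) \<and>
     chernoff_exp \<rho> (type2_mixture q) < (INF \<sigma>\<in>set_pmf q. chernoff_exp \<rho> (type2_simple \<sigma>))) \<and>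
    (\<forall>r>0.
       direct_exp r \<rho> (type2_composite (set_pmf q)) \<le> direct_exp r \<rho> (type2_mixture q) \<and>
       direct_exp r \<rho> (type2_mixture q) < (INF \<sigma>\<in>set_pmf q. direct_exp r \<rho> (type2_simple \<sigma>))) \<and>
    stein_exp \<rho> (type2_composite (set_pmf q)) < stein_exp \<rho> (type2_mixture q) \<and>
    chernoff_exp \<rho> (type2_composite (set_pmf q)) < chernoff_exp \<rho> (type2_mixture q) \<and>
    (\<forall>r. 0 < r \<and> ereal r < stein_exp \<rho> (type2_mixture q) \<longrightarrow>
       direct_exp r \<rho> (type2_composite (set_pmf q)) < direct_exp r \<rho> (type2_mixture q))"
proof (rule exI[of _ uniform], rule exI[of _ density_pmf], unfold set_density_pmf, intro conjI allI impI)
  show "infinite (range half_density)" using inj_half_density by (simp add: finite_image_iff)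
  show "stein_exp uniform (type2_mixture density_pmf)
      < (INF \<sigma>\<in>range half_density. stein_exp uniform (type2_simple \<sigma>))"
    using stein_exp_mixture_le by (simp add: stein_exp_simple image_image) (auto simp: le_less_trans)
  have "ereal (ln 2) \<le> (INF \<sigma>\<in>range half_density. chernoff_exp uniform (type2_simple \<sigma>))"
    by (rule INF_greatest) (auto simp: chernoff_exp_simple)
  with chernoff_exp_mixture_less show "chernoff_exp uniform (type2_mixture density_pmf)
      < (INF \<sigma>\<in>range half_density. chernoff_exp uniform (type2_simple \<sigma>))"
    by (rule less_le_trans)
next
  fix r :: real assume r: "0 < r"
  show "direct_exp r uniform (type2_composite (range half_density))
      \<le> direct_exp r uniform (type2_mixture density_pmf)"
    using direct_exp_composite[OF r] direct_exp_mixture_nonneg by (rule order_trans)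
  obtain s where s: "s < ln 2" "direct_exp r uniform (type2_mixture density_pmf) \<le> ereal s"
    using direct_exp_mixture_less[OF r] .
  have "ereal (ln 2) \<le> (INF \<sigma>\<in>range half_density. direct_exp r uniform (type2_simple \<sigma>))"
    by (rule INF_greatest) (auto simp: direct_exp_simple)
  moreover have "direct_exp r uniform (type2_mixture density_pmf) < ereal (ln 2)"
    using s by (auto intro: le_less_trans)
  ultimately show "direct_exp r uniform (type2_mixture density_pmf)
      < (INF \<sigma>\<in>range half_density. direct_exp r uniform (type2_simple \<sigma>))"
    by (rule less_le_trans[rotated])
next
  fix r :: real
  assume r: "0 < r \<and> ereal r < stein_exp uniform (type2_mixture density_pmf)"
  \<comment> \<open>Below the Stein exponent of the mixture, the prefix tests guarantee the positive
    rate \<open>ln 2 - r\<close>.\<close>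
  then have "ereal r < ereal (ln 2)" using stein_exp_mixture_le by (metis less_le_trans)
  then have pos: "0 < ereal (ln 2 - r)" by simp
  have "direct_exp r uniform (type2_composite (range half_density)) \<le> 0"
    using r by (intro direct_exp_composite) simp
  also have "0 < direct_exp r uniform (type2_mixture density_pmf)"
    using pos direct_exp_mixture_ge by (rule less_le_trans)
  finally show "direct_exp r uniform (type2_composite (range half_density))
      < direct_exp r uniform (type2_mixture density_pmf)" .
qed (use prob_density_uniform distribution_density_pmf stein_exp_composite_less
      chernoff_exp_composite_less in \<open>auto intro: less_imp_le\<close>)

end
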